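(* Let $\mathcal{C}$ be an arbitrary category and let $F, G$ be objects in $\overline{\mathrm{Pro}}(\mathcal{C})$. Then every connected component of the poset of pre morphisms from $F$ to $G$ (that is, every morphism from $F$ to $G$ in $\overline{\mathrm{Pro}}(\mathcal{C})$) is directed.
   Context: Posets. A poset $T$ is viewed as a category with a single morphism $u\to v$ iff $u\ge v$. $T$ is cofinite if $\{z\in T: z\le x\}$ is finite for every $x\in T$; a poset is directed if it is nonempty and any two elements have a common upper bound. A cofinite directed set $A$ has infinite height if for every $a\in A$ there is $a'\in A$ with $a<a'$. Objects of $\overline{\mathrm{Pro}}(\mathcal{C})$ are diagrams $F:A\to\mathcal{C}$ with $A$ a (small) cofinite directed set of infinite height. For objects $F:A\to\mathcal{C}$, $G:B\to\mathcal{C}$, a pre morphism from $F$ to $G$ is a pair $(\alpha,\phi)$ with $\alpha:B\to A$ a strictly increasing function and $\phi:F\circ\alpha\to G$ a natural transformation. Pre morphisms from $F$ to $G$ are partially ordered by: $(\alpha',\phi')\ge(\alpha,\phi)$ iff for every $b\in B$, $\alpha'(b)\ge\alpha(b)$ and $\phi'_b$ equals the composite $F(\alpha'(b))\to F(\alpha(b))\xrightarrow{\phi_b}G(b)$. A morphism $F\to G$ in $\overline{\mathrm{Pro}}(\mathcal{C})$ is by definition a connected component of this poset. *)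

theory Defs
  imports "HOL-Library.FuncSet"
begin

section \<open>Categories, functors, natural transformations\<close>

record ('o, 'm) category =
  Obj  :: "'o set"
  Arr  :: "'m set"
  Dom  :: "'m \<Rightarrow> 'o"
  Cod  :: "'m \<Rightarrow> 'o"
  Idt  :: "'o \<Rightarrow> 'm"
  Comp :: "'m \<Rightarrow> 'm \<Rightarrow> 'm"  \<comment> \<open>\<open>Comp C g f\<close> is \<open>g\<close> after \<open>f\<close>\<close>

definition hom :: "('o, 'm) category \<Rightarrow> 'o \<Rightarrow> 'o \<Rightarrow> 'm set" where
  "hom C x y = {f \<in> Arr C. Dom C f = x \<and> Cod C f = y}"

locale category =
  fixes C :: "('o, 'm) category"
  assumes Dom_in_Obj: "f \<in> Arr C \<Longrightarrow> Dom C f \<in> Obj C"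
    and Cod_in_Obj: "f \<in> Arr C \<Longrightarrow> Cod C f \<in> Obj C"
    and Idt_in_hom: "x \<in> Obj C \<Longrightarrow> Idt C x \<in> hom C x x"
    and Comp_in_hom: "f \<in> hom C x y \<Longrightarrow> g \<in> hom C y z \<Longrightarrow> Comp C g f \<in> hom C x z"
    and Comp_Idt_right: "f \<in> hom C x y \<Longrightarrow> Comp C f (Idt C x) = f"
    and Comp_Idt_left: "f \<in> hom C x y \<Longrightarrow> Comp C (Idt C y) f = f"
    and Comp_assoc: "f \<in> hom C w x \<Longrightarrow> g \<in> hom C x y \<Longrightarrow> h \<in> hom C y z \<Longrightarrow>
          Comp C h (Comp C g f) = Comp C (Comp C h g) f"

record ('i, 'k, 'o, 'm) cat_map =
  OMap :: "'i \<Rightarrow> 'o"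
  AMap :: "'k \<Rightarrow> 'm"

locale cat_functor = J: category J + C: category C
  for J :: "('i, 'k) category" and C :: "('o, 'm) category" +
  fixes F :: "('i, 'k, 'o, 'm) cat_map"
  assumes OMap_in_Obj: "i \<in> Obj J \<Longrightarrow> OMap F i \<in> Obj C"
    and AMap_in_hom: "f \<in> hom J i j \<Longrightarrow> AMap F f \<in> hom C (OMap F i) (OMap F j)"
    and AMap_Idt: "i \<in> Obj J \<Longrightarrow> AMap F (Idt J i) = Idt C (OMap F i)"
    and AMap_Comp: "f \<in> hom J i j \<Longrightarrow> g \<in> hom J j k \<Longrightarrow>
          AMap F (Comp J g f) = Comp C (AMap F g) (AMap F f)"

definition functor_comp ::
  "('i, 'k, 'o, 'm) cat_map \<Rightarrow> ('i', 'k', 'i, 'k) cat_map \<Rightarrow> ('i', 'k', 'o, 'm) cat_map" where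
  "functor_comp F H = \<lparr>OMap = OMap F \<circ> OMap H, AMap = AMap F \<circ> AMap H\<rparr>"

locale nat_trans = F: cat_functor J C F + G: cat_functor J C G
  for J :: "('i, 'k) category" and C :: "('o, 'm) category" and F and G +
  fixes \<phi> :: "'i \<Rightarrow> 'm"
  assumes component_in_hom: "i \<in> Obj J \<Longrightarrow> \<phi> i \<in> hom C (OMap F i) (OMap G i)"
    and naturality: "f \<in> hom J i j \<Longrightarrow>
          Comp C (\<phi> j) (AMap F f) = Comp C (AMap G f) (\<phi> i)"

section \<open>Posets\<close>

text \<open>
  A poset is a carrier set \<open>A\<close> with a relation \<open>r\<close> such that \<open>partial_order_on A r\<close>, where
  \<open>(x, y) \<in> r\<close> means \<open>x \<le> y\<close>. The pair \<open>(u, v)\<close> is the unique morphism from \<open>u\<close> to \<open>v\<close> of the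
  associated category, and it exists iff \<open>u \<ge> v\<close>; hence the converse of \<open>r\<close> below.
\<close>

definition poset_category :: "'a set \<Rightarrow> 'a rel \<Rightarrow> ('a, 'a \<times> 'a) category" where
  "poset_category A r =
     \<lparr>Obj = A, Arr = r\<inverse>, Dom = fst, Cod = snd, Idt = (\<lambda>u. (u, u)),
      Comp = (\<lambda>g f. (fst f, snd g))\<rparr>"

definition poset_map :: "('b \<Rightarrow> 'a) \<Rightarrow> ('b, 'b \<times> 'b, 'a, 'a \<times> 'a) cat_map" where
  "poset_map \<alpha> = \<lparr>OMap = \<alpha>, AMap = map_prod \<alpha> \<alpha>\<rparr>"

definition strictly_increasing_on ::
  "'b set \<Rightarrow> 'b rel \<Rightarrow> 'a rel \<Rightarrow> ('b \<Rightarrow> 'a) \<Rightarrow> bool" where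
  "strictly_increasing_on B s r \<alpha> \<longleftrightarrow>
     monotone_on B (\<lambda>b b'. (b, b') \<in> s \<and> b \<noteq> b') (\<lambda>a a'. (a, a') \<in> r \<and> a \<noteq> a') \<alpha>"

definition directed_poset :: "'a set \<Rightarrow> 'a rel \<Rightarrow> bool" where
  "directed_poset A r \<longleftrightarrow>
     partial_order_on A r \<and> A \<noteq> {} \<and> (\<forall>x\<in>A. \<forall>y\<in>A. \<exists>z\<in>A. (x, z) \<in> r \<and> (y, z) \<in> r)"

definition cofinite_poset :: "'a set \<Rightarrow> 'a rel \<Rightarrow> bool" where
  "cofinite_poset A r \<longleftrightarrow> partial_order_on A r \<and> (\<forall>x\<in>A. finite {z \<in> A. (z, x) \<in> r})"

definition infinite_height :: "'a set \<Rightarrow> 'a rel \<Rightarrow> bool" where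
  "infinite_height A r \<longleftrightarrow> (\<forall>a\<in>A. \<exists>a'\<in>A. (a, a') \<in> r \<and> a \<noteq> a')"

text \<open>
  Connected components of a poset: the classes of the equivalence relation generated by the
  order, i.e. two elements are equivalent iff a finite zigzag of comparabilities joins them.
\<close>

definition connected_components :: "'a set \<Rightarrow> 'a rel \<Rightarrow> 'a set set" where
  "connected_components P r = P // (r \<union> r\<inverse>)\<^sup>*"

lemma category_poset_category:
  assumes "partial_order_on A r"
  shows "category (poset_category A r)"
  using assms
  by (unfold_locales)
    (auto simp: poset_category_def hom_def partial_order_on_def preorder_on_def
      dest: refl_onD transD)

lemma cat_functor_poset_map:
  assumes "partial_order_on B s" "partial_order_on A r" "\<alpha> \<in> B \<rightarrow> A"
    and "strictly_increasing_on B s r \<alpha>"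
  shows "cat_functor (poset_category B s) (poset_category A r) (poset_map \<alpha>)"
proof -
  interpret B: category "poset_category B s"
    by (rule category_poset_category) fact
  interpret A: category "poset_category A r"
    by (rule category_poset_category) fact
  have mono: "(\<alpha> b, \<alpha> b') \<in> r" if "(b, b') \<in> s" for b b'
  proof -
    have "b \<in> B" "b' \<in> B"
      using that assms(1) by (auto simp: partial_order_on_def preorder_on_def)
    then show ?thesis
      using that assms(2-4)
      by (cases "b = b'")
        (auto simp: strictly_increasing_on_def monotone_on_def partial_order_on_def
          preorder_on_def refl_on_def)
  qed
  show ?thesis
    using assms(3)
    by unfold_locales (auto simp: poset_category_def poset_map_def hom_def intro: mono)
qed

section \<open>Pre morphisms between objects of the category \<open>Pro\<close>\<close>

record ('a, 'o, 'm) pro_diagram =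
  Index :: "'a set"
  Leq   :: "'a rel"
  Diag  :: "('a, 'a \<times> 'a, 'o, 'm) cat_map"

definition index_category :: "('a, 'o, 'm) pro_diagram \<Rightarrow> ('a, 'a \<times> 'a) category" where
  "index_category F = poset_category (Index F) (Leq F)"

definition pro_object :: "('o, 'm) category \<Rightarrow> ('a, 'o, 'm) pro_diagram \<Rightarrow> bool" where
  "pro_object C F \<longleftrightarrow>
     cofinite_poset (Index F) (Leq F) \<and> directed_poset (Index F) (Leq F) \<and>
     infinite_height (Index F) (Leq F) \<and>
     cat_functor (index_category F) C (Diag F)"

text \<open>
  Both components of a pre morphism are functions on the index set of the target; they are
  required to be \<^const>\<open>undefined\<close> outside it, so that equality of pairs is equality of pre
  morphisms.
\<close>

definition pre_morphisms ::
  "('o, 'm) category \<Rightarrow> ('a, 'o, 'm) pro_diagram \<Rightarrow> ('b, 'o, 'm) pro_diagram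
     \<Rightarrow> (('b \<Rightarrow> 'a) \<times> ('b \<Rightarrow> 'm)) set" where
  "pre_morphisms C F G =
     {(\<alpha>, \<phi>). \<alpha> \<in> Index G \<rightarrow>\<^sub>E Index F \<and>
        strictly_increasing_on (Index G) (Leq G) (Leq F) \<alpha> \<and>
        \<phi> \<in> extensional (Index G) \<and>
        nat_trans (index_category G) C (functor_comp (Diag F) (poset_map \<alpha>)) (Diag G) \<phi>}"

definition pre_morphism_order ::
  "('o, 'm) category \<Rightarrow> ('a, 'o, 'm) pro_diagram \<Rightarrow> ('b, 'o, 'm) pro_diagram
     \<Rightarrow> (('b \<Rightarrow> 'a) \<times> ('b \<Rightarrow> 'm)) rel" where
  "pre_morphism_order C F G =
     {((\<alpha>, \<phi>), (\<alpha>', \<phi>')). (\<alpha>, \<phi>) \<in> pre_morphisms C F G \<and> (\<alpha>', \<phi>') \<in> pre_morphisms C F G \<and>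
        (\<forall>b\<in>Index G. (\<alpha> b, \<alpha>' b) \<in> Leq F \<and>
           \<phi>' b = Comp C (\<phi> b) (AMap (Diag F) (\<alpha>' b, \<alpha> b)))}"

definition pro_hom ::
  "('o, 'm) category \<Rightarrow> ('a, 'o, 'm) pro_diagram \<Rightarrow> ('b, 'o, 'm) pro_diagram
     \<Rightarrow> (('b \<Rightarrow> 'a) \<times> ('b \<Rightarrow> 'm)) set set" where
  "pro_hom C F G = connected_components (pre_morphisms C F G) (pre_morphism_order C F G)"

end

theory Submission
  imports Defs
begin

text \<open>
  Two pre morphisms \<open>(\<alpha>', \<phi>')\<close>, \<open>(\<alpha>'', \<phi>'')\<close> above a common \<open>(\<alpha>, \<phi>)\<close> have a common upper
  bound: any strictly increasing \<open>\<beta>\<close> dominating \<open>\<alpha>'\<close> and \<open>\<alpha>''\<close> works, because \<open>\<phi>'\<close> and \<open>\<phi>''\<close>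
  both restrict along \<open>\<beta>\<close> to the restriction of \<open>\<phi>\<close>. Such a \<open>\<beta>\<close> is built by recursion on the
  cofinite index poset of the target, using that the index poset of the source is directed and
  has infinite height. In a poset with this amalgamation property, having a common upper bound
  propagates along zigzags.
\<close>

section \<open>Connected components of posets with amalgamation\<close>

lemma partial_order_onE:
  assumes "partial_order_on A r"
  obtains "r \<subseteq> A \<times> A" "\<And>x. x \<in> A \<Longrightarrow> (x, x) \<in> r"
    "\<And>x y z. (x, y) \<in> r \<Longrightarrow> (y, z) \<in> r \<Longrightarrow> (x, z) \<in> r"
    "\<And>x y. (x, y) \<in> r \<Longrightarrow> (y, x) \<in> r \<Longrightarrow> x = y"
proof (rule that)
  show "r \<subseteq> A \<times> A"
    using assms by (auto simp: partial_order_on_def preorder_on_def)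
  show "(x, x) \<in> r" if "x \<in> A" for x
    using assms that by (auto simp: partial_order_on_def preorder_on_def dest: refl_onD)
  show "(x, z) \<in> r" if "(x, y) \<in> r" "(y, z) \<in> r" for x y z
    using assms that by (auto simp: partial_order_on_def preorder_on_def dest: transD)
  show "x = y" if "(x, y) \<in> r" "(y, x) \<in> r" for x y
    using assms that by (auto simp: partial_order_on_def dest: antisymD)
qed

text \<open>Having a common upper bound with a fixed element survives each step of a zigzag: a step
  down keeps the old bound, and a step up amalgamates the old bound with the new element. A bound of
  two elements of \<open>K\<close> stays in \<open>K\<close>, being one comparability away.\<close>

lemma directed_poset_connected_component:
  assumes po: "partial_order_on P r"
    and amalgamate: "\<And>x y z. (x, y) \<in> r \<Longrightarrow> (x, z) \<in> r \<Longrightarrow> \<exists>w. (y, w) \<in> r \<and> (z, w) \<in> r"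
    and K: "K \<in> connected_components P r"
  shows "directed_poset K (Restr r K)"
proof -
  let ?R = "(r \<union> r\<inverse>)\<^sup>*"
  obtain sub: "r \<subseteq> P \<times> P" and refl: "\<And>x. x \<in> P \<Longrightarrow> (x, x) \<in> r"
    and trans: "\<And>x y z. (x, y) \<in> r \<Longrightarrow> (y, z) \<in> r \<Longrightarrow> (x, z) \<in> r"
    and antisym: "\<And>x y. (x, y) \<in> r \<Longrightarrow> (y, x) \<in> r \<Longrightarrow> x = y"
    using po by (rule partial_order_onE) blast
  obtain x where x: "x \<in> P" and K_eq: "K = ?R `` {x}"
    using K by (auto simp: connected_components_def elim: quotientE)
  \<comment> \<open>\<open>?R\<close> is reflexive on the whole type, so remaining in
    \<open>P\<close> has to be traced along the zigzag.\<close>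
  have in_P: "y \<in> P" if "(x', y) \<in> ?R" "x' \<in> P" for x' y
    using that by induction (use sub in auto)
  have bound: "\<exists>w. (x', w) \<in> r \<and> (y, w) \<in> r" if "(x', y) \<in> ?R" "x' \<in> P" for x' y
    using that(1)
  proof induction
    case base
    then show ?case using refl that(2) by blast
  next
    case (step y z)
    then obtain w where w: "(x', w) \<in> r" "(y, w) \<in> r" by blast
    show ?case
    proof (cases "(z, y) \<in> r")
      case True
      then show ?thesis using w trans by blast
    next
      case False
      then have "(y, z) \<in> r" using step by blast
      then show ?thesis using amalgamate w trans by meson
    qed
  qed
  have K_sub: "K \<subseteq> P"
    using x in_P K_eq by auto
  have "\<exists>z\<in>K. (y, z) \<in> Restr r K \<and> (y', z) \<in> Restr r K"
    if yy': "y \<in> K" "y' \<in> K" for y y'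
  proof -
    \<comment> \<open>Both elements are related to \<open>x\<close> only; symmetry joins the two
      zigzags into one from \<open>y\<close> to \<open>y'\<close>.\<close>
    have "sym ?R" by (simp add: sym_rtrancl sym_Un_converse)
    then have "(y, y') \<in> ?R"
      using that K_eq by (auto dest: symD intro: rtrancl_trans)
    then obtain z where z: "(y, z) \<in> r" "(y', z) \<in> r"
      using bound yy' K_sub by blast
    then have "z \<in> K"
      using that K_eq by (auto intro: rtrancl_into_rtrancl)
    then show ?thesis using z that by blast
  qed
  moreover have "partial_order_on K (Restr r K)"
    using K_sub refl trans antisym
    unfolding partial_order_on_def preorder_on_def refl_on_def trans_def antisym_def
    by blast
  ultimately show ?thesis
    using K_eq unfolding directed_poset_def by blast
qed

section \<open>Upper bounds and strictly increasing functions\<close>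

lemma directed_poset_finite_bound:
  assumes "directed_poset A r" "finite X" "X \<subseteq> A"
  shows "\<exists>a\<in>A. \<forall>x\<in>X. (x, a) \<in> r"
  using assms(2,3)
proof induction
  case empty
  then show ?case using assms(1) by (auto simp: directed_poset_def)
next
  case (insert y X)
  obtain trans: "\<And>x y z. (x, y) \<in> r \<Longrightarrow> (y, z) \<in> r \<Longrightarrow> (x, z) \<in> r"
    using assms(1) by (auto simp: directed_poset_def elim: partial_order_onE)
  obtain a where "a \<in> A" "\<forall>x\<in>X. (x, a) \<in> r" using insert by auto
  moreover from this obtain c where "c \<in> A" "(a, c) \<in> r" "(y, c) \<in> r"
    using insert.prems assms(1) unfolding directed_poset_def by blast
  ultimately show ?case using trans by blast
qed

text \<open>Infinite height gives some \<open>a'\<close> strictly above a bound \<open>a\<close>. If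
  \<open>a'\<close> were in \<open>X\<close>, it would lie below \<open>a\<close>, and antisymmetry
  would force \<open>a = a'\<close>.\<close>

lemma directed_poset_finite_strict_bound:
  assumes "directed_poset A r" "infinite_height A r" "finite X" "X \<subseteq> A"
  shows "\<exists>a\<in>A. \<forall>x\<in>X. (x, a) \<in> r \<and> x \<noteq> a"
proof -
  obtain trans: "\<And>x y z. (x, y) \<in> r \<Longrightarrow> (y, z) \<in> r \<Longrightarrow> (x, z) \<in> r"
    and antisym: "\<And>x y. (x, y) \<in> r \<Longrightarrow> (y, x) \<in> r \<Longrightarrow> x = y"
    using assms(1) by (auto simp: directed_poset_def elim: partial_order_onE)
  obtain a where "a \<in> A" "\<forall>x\<in>X. (x, a) \<in> r"
    using directed_poset_finite_bound assms(1,3,4) by blast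
  moreover from this obtain a' where "a' \<in> A" "(a, a') \<in> r" "a \<noteq> a'"
    using assms(2) unfolding infinite_height_def by blast
  ultimately show ?thesis using trans antisym by blast
qed

text \<open>The size of the down-set is a rank: for \<open>b\<close> strictly below
  \<open>b'\<close>, the finite down-set of \<open>b'\<close> contains that of \<open>b\<close> and
  also \<open>b'\<close> itself. This licenses recursion over the target's index poset.\<close>

lemma cofinite_poset_wf:
  assumes "cofinite_poset B s"
  shows "wf (s - Id)"
proof (rule wf_subset[OF wf_measure])
  show "s - Id \<subseteq> measure (\<lambda>b. card {z \<in> B. (z, b) \<in> s})"
  proof (rule subrelI)
    fix b b' assume bb': "(b, b') \<in> s - Id"
    obtain "s \<subseteq> B \<times> B" "\<And>x. x \<in> B \<Longrightarrow> (x, x) \<in> s"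
      "\<And>x y z. (x, y) \<in> s \<Longrightarrow> (y, z) \<in> s \<Longrightarrow> (x, z) \<in> s"
      "\<And>x y. (x, y) \<in> s \<Longrightarrow> (y, x) \<in> s \<Longrightarrow> x = y"
      using assms by (auto simp: cofinite_poset_def elim: partial_order_onE)
    with bb' have "{z \<in> B. (z, b) \<in> s} \<subset> {z \<in> B. (z, b') \<in> s}" "b' \<in> B"
      by blast+
    with assms show "(b, b') \<in> measure (\<lambda>b. card {z \<in> B. (z, b) \<in> s})"
      by (auto simp: cofinite_poset_def intro!: psubset_card_mono)
  qed
qed

text \<open>Well-founded recursion: the value at \<open>b\<close> must exceed only finitely many
  elements, namely those of \<open>S b\<close> and the values chosen at the finitely many strict
  predecessors of \<open>b\<close>.\<close>

lemma strictly_increasing_bound: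
  assumes B: "cofinite_poset B s"
    and A: "directed_poset A r" "infinite_height A r"
    and S: "\<And>b. b \<in> B \<Longrightarrow> finite (S b)" "\<And>b. b \<in> B \<Longrightarrow> S b \<subseteq> A"
  shows "\<exists>\<beta> \<in> B \<rightarrow>\<^sub>E A. strictly_increasing_on B s r \<beta> \<and> (\<forall>b\<in>B. \<forall>a\<in>S b. (a, \<beta> b) \<in> r)"
proof -
  \<comment> \<open>\<open>Q f b c\<close> says that \<open>c\<close> is admissible at
    \<open>b\<close> given the values of \<open>f\<close> below \<open>b\<close>. It is vacuous
    outside \<open>B\<close> because the recursion runs over the whole type.\<close>
  define Q where "Q f b c \<longleftrightarrow> (b \<in> B \<longrightarrow> c \<in> A \<and> (\<forall>a\<in>S b. (a, c) \<in> r) \<and>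
      (\<forall>b'. (b', b) \<in> s - Id \<longrightarrow> (f b', c) \<in> r \<and> f b' \<noteq> c))" for f :: "'a \<Rightarrow> 'b" and b c
  have s_sub: "s \<subseteq> B \<times> B"
    using B by (auto simp: cofinite_poset_def elim: partial_order_onE)
  have "\<exists>f. \<forall>b. Q f b (f b)"
  \<comment> \<open>Two obligations: \<open>Q\<close> looks at \<open>f\<close> only strictly below
    \<open>b\<close>, and admissible values below \<open>b\<close> leave one at
    \<open>b\<close>.\<close>
  proof (rule dependent_wf_choice[OF cofinite_poset_wf[OF B]])
    show "Q f b c = Q g b c" if "\<And>z. (z, b) \<in> s - Id \<Longrightarrow> f z = g z" for f g b c
      using that unfolding Q_def by metis
    show "\<exists>c. Q f b c" if f: "\<And>b'. (b', b) \<in> s - Id \<Longrightarrow> Q f b' (f b')" for b f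
    proof (cases "b \<in> B")
      case True
      let ?X = "S b \<union> f ` {b'. (b', b) \<in> s - Id}"
      have "{b'. (b', b) \<in> s - Id} \<subseteq> {z \<in> B. (z, b) \<in> s}"
        using s_sub by blast
      then have "finite {b'. (b', b) \<in> s - Id}"
        using B True by (auto simp: cofinite_poset_def intro: finite_subset)
      then have "finite ?X" using S True by blast
      moreover have "?X \<subseteq> A"
        using f S True s_sub unfolding Q_def by blast
      ultimately obtain c where "c \<in> A" "\<forall>x\<in>?X. (x, c) \<in> r \<and> x \<noteq> c"
        using directed_poset_finite_strict_bound[OF A] by meson
      then show ?thesis unfolding Q_def by blast
    qed (simp add: Q_def)
  qed
  then obtain f where f: "\<And>b. Q f b (f b)" by blast
  have "restrict f B \<in> B \<rightarrow>\<^sub>E A" "\<forall>b\<in>B. \<forall>a\<in>S b. (a, restrict f B b) \<in> r"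
    using f unfolding Q_def by auto
  moreover have "strictly_increasing_on B s r (restrict f B)"
    using f unfolding Q_def strictly_increasing_on_def monotone_on_def by simp
  ultimately show ?thesis by blast
qed

section \<open>Composite functors and morphisms of poset categories\<close>

lemma cat_functor_functor_comp:
  assumes "cat_functor J C F" "cat_functor I J H"
  shows "cat_functor I C (functor_comp F H)"
proof -
  interpret F: cat_functor J C F by fact
  interpret H: cat_functor I J H by fact
  show ?thesis
  proof unfold_locales
    fix f g i j k assume "f \<in> hom I i j" "g \<in> hom I j k"
    then show "AMap (functor_comp F H) (Comp I g f) =
        Comp C (AMap (functor_comp F H) g) (AMap (functor_comp F H) f)"
      by (simp add: functor_comp_def H.AMap_Comp F.AMap_Comp[OF H.AMap_in_hom H.AMap_in_hom])
  qed (auto simp: functor_comp_def F.OMap_in_Obj H.OMap_in_Obj F.AMap_in_hom H.AMap_in_hom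
      F.AMap_Idt H.AMap_Idt)
qed

lemma hom_poset_category:
  "partial_order_on A r \<Longrightarrow> f \<in> hom (poset_category A r) u v \<longleftrightarrow> f = (u, v) \<and> (v, u) \<in> r"
  by (cases f) (auto simp: hom_def poset_category_def)

section \<open>Transition maps of two fixed objects\<close>

locale pro_pair =
  fixes C :: "('o, 'm) category"
    and F :: "('a, 'o, 'm) pro_diagram"
    and G :: "('b, 'o, 'm) pro_diagram"
  assumes pro_F: "pro_object C F" and pro_G: "pro_object C G"
begin

sublocale F: cat_functor "index_category F" C "Diag F"
  using pro_F by (simp add: pro_object_def)

sublocale G: cat_functor "index_category G" C "Diag G"
  using pro_G by (simp add: pro_object_def)

lemma partial_order_F: "partial_order_on (Index F) (Leq F)"
  using pro_F by (simp add: pro_object_def cofinite_poset_def)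

lemma partial_order_G: "partial_order_on (Index G) (Leq G)"
  using pro_G by (simp add: pro_object_def cofinite_poset_def)

lemma Leq_F_trans: "(u, v) \<in> Leq F \<Longrightarrow> (v, w) \<in> Leq F \<Longrightarrow> (u, w) \<in> Leq F"
  using partial_order_F by (blast elim: partial_order_onE)

lemma hom_index_F: "f \<in> hom (index_category F) u v \<longleftrightarrow> f = (u, v) \<and> (v, u) \<in> Leq F"
  by (simp add: index_category_def hom_poset_category partial_order_F)

lemma hom_index_G: "f \<in> hom (index_category G) u v \<longleftrightarrow> f = (u, v) \<and> (v, u) \<in> Leq G"
  by (simp add: index_category_def hom_poset_category partial_order_G)

lemma Obj_index_G [simp]: "Obj (index_category G) = Index G"
  by (simp add: index_category_def poset_category_def)

lemma transition_in_hom: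
  "(v, u) \<in> Leq F \<Longrightarrow> AMap (Diag F) (u, v) \<in> hom C (OMap (Diag F) u) (OMap (Diag F) v)"
  by (rule F.AMap_in_hom) (simp add: hom_index_F)

lemma transition_in_hom_G:
  "(v, u) \<in> Leq G \<Longrightarrow> AMap (Diag G) (u, v) \<in> hom C (OMap (Diag G) u) (OMap (Diag G) v)"
  by (rule G.AMap_in_hom) (simp add: hom_index_G)

lemma transition_Idt: "u \<in> Index F \<Longrightarrow> AMap (Diag F) (u, u) = Idt C (OMap (Diag F) u)"
  using F.AMap_Idt[of u] by (simp add: index_category_def poset_category_def)

lemma transition_Comp:
  "(v, u) \<in> Leq F \<Longrightarrow> (w, v) \<in> Leq F \<Longrightarrow>
    Comp C (AMap (Diag F) (v, w)) (AMap (Diag F) (u, v)) = AMap (Diag F) (u, w)"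
  using F.AMap_Comp[of "(u, v)" u v "(v, w)" w]
  \<comment> \<open>\<open>hom_index_F\<close> discharges the premises while
    \<open>index_category\<close> is still folded; it is then unfolded to compute the composite
    pair.\<close>
  by (simp add: hom_index_F) (simp add: index_category_def poset_category_def)

text \<open>Restricting in two stages equals restricting at once. This calculation underlies
  naturality of restrictions, transitivity of the order, and amalgamation.\<close>

lemma Comp_transition_assoc:
  assumes "f \<in> hom C (OMap (Diag F) w) y" "(v, u) \<in> Leq F" "(w, v) \<in> Leq F"
  shows "Comp C (Comp C f (AMap (Diag F) (v, w))) (AMap (Diag F) (u, v)) =
    Comp C f (AMap (Diag F) (u, w))"
  using F.C.Comp_assoc[OF transition_in_hom[OF assms(2)] transition_in_hom[OF assms(3)] assms(1)]
  by (simp add: transition_Comp assms(2,3))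

section \<open>Pre morphisms in elementary terms and their restriction\<close>

lemma increasing:
  assumes "\<alpha> \<in> Index G \<rightarrow>\<^sub>E Index F" "strictly_increasing_on (Index G) (Leq G) (Leq F) \<alpha>"
    and "(b', b) \<in> Leq G"
  shows "(\<alpha> b', \<alpha> b) \<in> Leq F"
  \<comment> \<open>Strict increase speaks only of distinct elements; functoriality of
    \<open>poset_map \<alpha>\<close> also covers \<open>b' = b\<close>.\<close>
  using cat_functor.AMap_in_hom[OF cat_functor_poset_map, of "Index G" "Leq G" "Index F" "Leq F" \<alpha>
      "(b, b')" b b'] partial_order_F partial_order_G assms
  by (auto simp: hom_poset_category poset_map_def)

text \<open>Both functors in question exist automatically once \<alpha> is strictly increasing, so
  naturality reduces to conditions on components and on the pairs in \<open>Leq G\<close>.\<close>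

lemma pre_morphisms_iff:
  "(\<alpha>, \<phi>) \<in> pre_morphisms C F G \<longleftrightarrow>
     \<alpha> \<in> Index G \<rightarrow>\<^sub>E Index F \<and> strictly_increasing_on (Index G) (Leq G) (Leq F) \<alpha> \<and>
     \<phi> \<in> extensional (Index G) \<and>
     (\<forall>b\<in>Index G. \<phi> b \<in> hom C (OMap (Diag F) (\<alpha> b)) (OMap (Diag G) b)) \<and>
     (\<forall>b b'. (b', b) \<in> Leq G \<longrightarrow>
        Comp C (\<phi> b') (AMap (Diag F) (\<alpha> b, \<alpha> b')) = Comp C (AMap (Diag G) (b, b')) (\<phi> b))"
proof -
  have "nat_trans (index_category G) C (functor_comp (Diag F) (poset_map \<alpha>)) (Diag G) \<phi> \<longleftrightarrow>
     (\<forall>b\<in>Index G. \<phi> b \<in> hom C (OMap (Diag F) (\<alpha> b)) (OMap (Diag G) b)) \<and>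
     (\<forall>b b'. (b', b) \<in> Leq G \<longrightarrow>
        Comp C (\<phi> b') (AMap (Diag F) (\<alpha> b, \<alpha> b')) = Comp C (AMap (Diag G) (b, b')) (\<phi> b))"
    if "\<alpha> \<in> Index G \<rightarrow>\<^sub>E Index F" "strictly_increasing_on (Index G) (Leq G) (Leq F) \<alpha>"
  proof -
    have "cat_functor (index_category G) (index_category F) (poset_map \<alpha>)"
      unfolding index_category_def using that partial_order_F partial_order_G
      by (intro cat_functor_poset_map) auto
    then have "cat_functor (index_category G) C (functor_comp (Diag F) (poset_map \<alpha>))"
      using F.cat_functor_axioms by (blast intro: cat_functor_functor_comp)
    then show ?thesis
      using G.cat_functor_axioms
      by (auto simp: nat_trans_def nat_trans_axioms_def hom_index_G functor_comp_def poset_map_def)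
  qed
  then show ?thesis
    unfolding pre_morphisms_def by blast
qed

text \<open>Produces the candidate upper bounds. Naturality pastes the commuting square of
  transition maps of \<open>F\<close> to the naturality square of \<phi>.\<close>

lemma pre_morphism_restrict:
  assumes \<alpha>\<phi>: "(\<alpha>, \<phi>) \<in> pre_morphisms C F G"
    and \<beta>: "\<beta> \<in> Index G \<rightarrow>\<^sub>E Index F" "strictly_increasing_on (Index G) (Leq G) (Leq F) \<beta>"
    and le: "\<And>b. b \<in> Index G \<Longrightarrow> (\<alpha> b, \<beta> b) \<in> Leq F"
  shows "(\<beta>, \<lambda>b\<in>Index G. Comp C (\<phi> b) (AMap (Diag F) (\<beta> b, \<alpha> b))) \<in> pre_morphisms C F G"
proof -
  note \<phi> = \<alpha>\<phi>[unfolded pre_morphisms_iff]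
  have hom: "\<phi> b \<in> hom C (OMap (Diag F) (\<alpha> b)) (OMap (Diag G) b)" if "b \<in> Index G" for b
    using \<phi> that by blast
  have nat: "Comp C (Comp C (\<phi> b') (AMap (Diag F) (\<beta> b', \<alpha> b'))) (AMap (Diag F) (\<beta> b, \<beta> b')) =
      Comp C (AMap (Diag G) (b, b')) (Comp C (\<phi> b) (AMap (Diag F) (\<beta> b, \<alpha> b)))"
    and Leq_in: "b \<in> Index G" "b' \<in> Index G" if "(b', b) \<in> Leq G" for b b'
  proof -
    show b: "b \<in> Index G" "b' \<in> Index G"
      using that partial_order_G by (blast elim: partial_order_onE)+
    have \<alpha>bb': "(\<alpha> b', \<alpha> b) \<in> Leq F" and \<beta>bb': "(\<beta> b', \<beta> b) \<in> Leq F"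
      using \<phi> \<beta> that increasing by blast+
    have "Comp C (Comp C (\<phi> b') (AMap (Diag F) (\<beta> b', \<alpha> b'))) (AMap (Diag F) (\<beta> b, \<beta> b')) =
        Comp C (\<phi> b') (AMap (Diag F) (\<beta> b, \<alpha> b'))"
      using Comp_transition_assoc hom b le \<beta>bb' by blast
    \<comment> \<open>The transition from \<open>\<beta> b\<close> to \<open>\<alpha> b'\<close> is
      factored anew, through \<open>\<alpha> b\<close> instead of \<open>\<beta> b'\<close>, so that
      naturality of \<phi> applies.\<close>
    also have "\<dots> = Comp C (Comp C (\<phi> b') (AMap (Diag F) (\<alpha> b, \<alpha> b'))) (AMap (Diag F) (\<beta> b, \<alpha> b))"
      using Comp_transition_assoc[OF hom[OF b(2)] le[OF b(1)] \<alpha>bb'] by simp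
    also have "Comp C (\<phi> b') (AMap (Diag F) (\<alpha> b, \<alpha> b')) = Comp C (AMap (Diag G) (b, b')) (\<phi> b)"
      using \<phi> that by blast
    also have "Comp C (Comp C (AMap (Diag G) (b, b')) (\<phi> b)) (AMap (Diag F) (\<beta> b, \<alpha> b)) =
        Comp C (AMap (Diag G) (b, b')) (Comp C (\<phi> b) (AMap (Diag F) (\<beta> b, \<alpha> b)))"
      using F.C.Comp_assoc[OF transition_in_hom[OF le[OF b(1)]] hom[OF b(1)]
          transition_in_hom_G[OF that]] by simp
    finally show "Comp C (Comp C (\<phi> b') (AMap (Diag F) (\<beta> b', \<alpha> b'))) (AMap (Diag F) (\<beta> b, \<beta> b')) =
      Comp C (AMap (Diag G) (b, b')) (Comp C (\<phi> b) (AMap (Diag F) (\<beta> b, \<alpha> b)))" .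
  qed
  show ?thesis
    unfolding pre_morphisms_iff
  proof (intro conjI allI impI ballI)
    fix b assume "b \<in> Index G"
    then show "(\<lambda>b\<in>Index G. Comp C (\<phi> b) (AMap (Diag F) (\<beta> b, \<alpha> b))) b
        \<in> hom C (OMap (Diag F) (\<beta> b)) (OMap (Diag G) b)"
      using F.C.Comp_in_hom transition_in_hom le hom by fastforce
  qed (use \<beta> nat Leq_in in simp_all)
qed

section \<open>The order on pre morphisms\<close>

lemma pre_morphism_order_iff:
  "((\<alpha>, \<phi>), (\<alpha>', \<phi>')) \<in> pre_morphism_order C F G \<longleftrightarrow>
     (\<alpha>, \<phi>) \<in> pre_morphisms C F G \<and> (\<alpha>', \<phi>') \<in> pre_morphisms C F G \<and>
     (\<forall>b\<in>Index G. (\<alpha> b, \<alpha>' b) \<in> Leq F \<and>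
        \<phi>' b = Comp C (\<phi> b) (AMap (Diag F) (\<alpha>' b, \<alpha> b)))"
  by (simp add: pre_morphism_order_def)

text \<open>Where two index functions agree, the equation in the order collapses to equality of
  components; reflexivity and antisymmetry rest on this.\<close>

lemma pre_morphism_Comp_Idt:
  assumes "(\<alpha>, \<phi>) \<in> pre_morphisms C F G" "b \<in> Index G"
  shows "Comp C (\<phi> b) (AMap (Diag F) (\<alpha> b, \<alpha> b)) = \<phi> b"
proof -
  have "\<alpha> b \<in> Index F" "\<phi> b \<in> hom C (OMap (Diag F) (\<alpha> b)) (OMap (Diag G) b)"
    using assms unfolding pre_morphisms_iff by auto
  then show ?thesis using transition_Idt F.C.Comp_Idt_right by simp
qed

lemma partial_order_pre_morphism_order:
  "partial_order_on (pre_morphisms C F G) (pre_morphism_order C F G)"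
  unfolding partial_order_on_def preorder_on_def
proof (intro conjI)
  show "pre_morphism_order C F G \<subseteq> pre_morphisms C F G \<times> pre_morphisms C F G"
    by (auto simp: pre_morphism_order_def)
  show "refl_on (pre_morphisms C F G) (pre_morphism_order C F G)"
  proof (rule refl_onI, clarify)
    fix \<alpha> \<phi> assume pre: "(\<alpha>, \<phi>) \<in> pre_morphisms C F G"
    have "(\<alpha> b, \<alpha> b) \<in> Leq F" if "b \<in> Index G" for b
      using pre that partial_order_F unfolding pre_morphisms_iff
      by (blast elim: partial_order_onE)
    then show "((\<alpha>, \<phi>), (\<alpha>, \<phi>)) \<in> pre_morphism_order C F G"
      using pre by (simp add: pre_morphism_order_iff pre_morphism_Comp_Idt)
  qed
  show "trans (pre_morphism_order C F G)"
  proof (rule transI, clarify)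
    fix \<alpha> \<phi> \<alpha>' \<phi>' \<alpha>'' \<phi>''
    assume "((\<alpha>, \<phi>), (\<alpha>', \<phi>')) \<in> pre_morphism_order C F G"
      "((\<alpha>', \<phi>'), (\<alpha>'', \<phi>'')) \<in> pre_morphism_order C F G"
    then show "((\<alpha>, \<phi>), (\<alpha>'', \<phi>'')) \<in> pre_morphism_order C F G"
      unfolding pre_morphism_order_iff
      by (auto simp: pre_morphisms_iff[of \<alpha>] Comp_transition_assoc intro: Leq_F_trans)
  qed
  show "antisym (pre_morphism_order C F G)"
  proof (rule antisymI, clarify)
    fix \<alpha> \<phi> \<alpha>' \<phi>'
    assume le: "((\<alpha>, \<phi>), (\<alpha>', \<phi>')) \<in> pre_morphism_order C F G"
      and ge: "((\<alpha>', \<phi>'), (\<alpha>, \<phi>)) \<in> pre_morphism_order C F G"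
    have pre: "(\<alpha>, \<phi>) \<in> pre_morphisms C F G" "(\<alpha>', \<phi>') \<in> pre_morphisms C F G"
      using le by (auto simp: pre_morphism_order_iff)
    have \<alpha>_eq: "\<alpha> b = \<alpha>' b" if "b \<in> Index G" for b
      using le ge that partial_order_F unfolding pre_morphism_order_iff
      by (blast elim: partial_order_onE)
    \<comment> \<open>Agreement on \<open>Index G\<close> suffices, here and for \<phi>, because
      these functions are \<open>undefined\<close> elsewhere.\<close>
    then have "\<alpha> = \<alpha>'"
      using pre unfolding pre_morphisms_iff by (blast intro: PiE_ext)
    moreover have "\<phi> b = \<phi>' b" if "b \<in> Index G" for b
      using le that \<alpha>_eq pre_morphism_Comp_Idt[OF pre(1) that]
      by (simp add: pre_morphism_order_iff)
    then have "\<phi> = \<phi>'"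
      using pre unfolding pre_morphisms_iff by (blast intro: extensionalityI)
    ultimately show "\<alpha> = \<alpha>' \<and> \<phi> = \<phi>'" by simp
  qed
qed

lemma pre_morphism_order_amalgamate:
  assumes "(p, p') \<in> pre_morphism_order C F G" "(p, p'') \<in> pre_morphism_order C F G"
  shows "\<exists>q. (p', q) \<in> pre_morphism_order C F G \<and> (p'', q) \<in> pre_morphism_order C F G"
proof -
  obtain \<alpha> \<phi> \<alpha>' \<phi>' \<alpha>'' \<phi>''
    where p: "p = (\<alpha>, \<phi>)" "p' = (\<alpha>', \<phi>')" "p'' = (\<alpha>'', \<phi>'')"
    by (metis surj_pair)
  note le = assms[unfolded p pre_morphism_order_iff]
  have img: "\<alpha>' b \<in> Index F" "\<alpha>'' b \<in> Index F" if "b \<in> Index G" for b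
    using le that by (auto simp: pre_morphisms_iff)
  obtain \<beta> where \<beta>: "\<beta> \<in> Index G \<rightarrow>\<^sub>E Index F"
      "strictly_increasing_on (Index G) (Leq G) (Leq F) \<beta>"
    and ge: "\<And>b. b \<in> Index G \<Longrightarrow> (\<alpha>' b, \<beta> b) \<in> Leq F \<and> (\<alpha>'' b, \<beta> b) \<in> Leq F"
    using strictly_increasing_bound[of "Index G" "Leq G" "Index F" "Leq F" "\<lambda>b. {\<alpha>' b, \<alpha>'' b}"]
      pro_F pro_G img by (auto simp: pro_object_def)
  \<comment> \<open>\<psi> restricts the common lower \<phi>, which keeps the argument symmetric in
    \<phi>' and \<phi>''.\<close>
  define \<psi> where "\<psi> = (\<lambda>b\<in>Index G. Comp C (\<phi> b) (AMap (Diag F) (\<beta> b, \<alpha> b)))"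
  have "(\<beta>, \<psi>) \<in> pre_morphisms C F G"
    unfolding \<psi>_def using le \<beta> ge by (intro pre_morphism_restrict) (auto intro: Leq_F_trans)
  \<comment> \<open>By the order, \<open>\<phi>' b\<close> is itself \<open>\<phi> b\<close> after a
    transition, so restricting it further to \<open>\<beta> b\<close> yields a two-stage restriction
    of \<open>\<phi> b\<close>; likewise for \<open>\<phi>'' b\<close>.\<close>
  moreover have "\<psi> b = Comp C (\<phi>' b) (AMap (Diag F) (\<beta> b, \<alpha>' b))"
    "\<psi> b = Comp C (\<phi>'' b) (AMap (Diag F) (\<beta> b, \<alpha>'' b))" if "b \<in> Index G" for b
    using le ge that by (auto simp: \<psi>_def pre_morphisms_iff[of \<alpha>] Comp_transition_assoc)
  ultimately have "(p', (\<beta>, \<psi>)) \<in> pre_morphism_order C F G"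
    "(p'', (\<beta>, \<psi>)) \<in> pre_morphism_order C F G"
    using le ge by (auto simp: p pre_morphism_order_iff)
  then show ?thesis by blast
qed

end

theorem corollary4p8:
  fixes C :: "('o, 'm) category"
    and F :: "('a, 'o, 'm) pro_diagram"
    and G :: "('b, 'o, 'm) pro_diagram"
  assumes "category C"
    and "pro_object C F"
    and "pro_object C G"
  shows "\<forall>K \<in> pro_hom C F G. directed_poset K (Restr (pre_morphism_order C F G) K)"
proof -
  interpret pro_pair C F G
    by unfold_locales fact+
  show ?thesis
    unfolding pro_hom_def
    using directed_poset_connected_component partial_order_pre_morphism_order
      pre_morphism_order_amalgamate by blast
qed

end
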